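(* For $q\in\mathbb{C}$ with $|q|<1$, $$\sum_{i,j\geq 0} \frac{q^{2i^2+2ij+j}}{(q^2;q^2)_{2i}(q^2;q^2)_{j}}=\frac{(q^3,q^4,q^7;q^7)_\infty}{(q;q)_\infty},\qquad \sum_{i,j\geq 0} \frac{q^{2i^2+2ij+2i+j}}{(q^2;q^2)_{2i}(q^2;q^2)_{j}}=\frac{(q^2,q^5,q^7;q^7)_\infty}{(q;q)_\infty},$$ $$\sum_{i,j\geq 0} \frac{q^{2i^2+2ij+2i+3j}}{(q^2;q^2)_{2i+1}(q^2;q^2)_{j}}=\frac{(q,q^6,q^7;q^7)_\infty}{(q;q)_\infty}.$$
   Context: For $|q|<1$: $(a;q)_\infty=\prod_{k\ge0}(1-aq^k)$; for integers $n\ge0$, $(a;q)_n=\prod_{k=0}^{n-1}(1-aq^k)$; and $(a_1,\dots,a_m;q)_\infty=\prod_{k=1}^m(a_k;q)_\infty$. *)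

theory Defs
  imports "HOL-Analysis.Analysis"
begin

definition qpoch :: "complex \<Rightarrow> complex \<Rightarrow> nat \<Rightarrow> complex" where
  "qpoch a q n = (\<Prod>k<n. 1 - a * q ^ k)"

definition qpoch_inf :: "complex \<Rightarrow> complex \<Rightarrow> complex" where
  "qpoch_inf a q = (\<Prod>k. 1 - a * q ^ k)"

text \<open>
  The product defining \<^term>\<open>qpoch_inf\<close> converges for every \<^term>\<open>a\<close>; a vanishing factor is
  allowed and makes the value zero.
\<close>
lemma qpoch_inf_convergent:
  fixes a q :: complex
  assumes "norm q < 1"
  shows "convergent_prod (\<lambda>k. 1 - a * q ^ k)"
proof -
  have "summable (\<lambda>k. norm (- a * q ^ k))"
    using assms by (simp add: norm_mult norm_power summable_mult summable_geometric)
  hence "abs_convergent_prod (\<lambda>k. 1 + (- a * q ^ k))"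
    by (intro summable_imp_abs_convergent_prod) (simp add: norm_mult)
  thus ?thesis
    using abs_convergent_prod_imp_convergent_prod by fastforce
qed

definition qpoch_inf_list :: "complex list \<Rightarrow> complex \<Rightarrow> complex" where
  "qpoch_inf_list as q = (\<Prod>a\<leftarrow>as. qpoch_inf a q)"

end

theory Submission
  imports Defs
begin

text \<open>
  Summing over \<open>j\<close> by Euler's identity reduces the three double sums to the Rogers--Selberg
  identities. Write \<open>Q = q^2\<close>. For the first one, the summand is \<open>Q^(n^2)\<close> times the term
  \<open>\<beta>\<^sub>n = (q; Q)\<^sub>n / (Q; Q)\<^sub>2\<^sub>n\<close> of a Bailey pair, that is,
  \<open>\<beta>\<^sub>n\<close> is the sum over all integers \<open>r\<close> of
  \<open>(-1)^r q^(r (3 r + 1) / 2) / ((Q; Q)\<^sub>n\<^sub>-\<^sub>r (Q; Q)\<^sub>n\<^sub>+\<^sub>r)\<close>. Such finite identities follow from the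
  q-Pascal rule combined with reflection and translation of \<open>r\<close>. Interchanging the two summations
  leaves an inner sum which is the Durfee rectangle identity and an outer theta series with
  exponents \<open>r (7 r + 1) / 2\<close>, which the Jacobi triple product evaluates. The triple product is
  itself the limit of a finite identity for the same kind of bilateral sums.
\<close>

section \<open>Summation over arbitrary index sets\<close>

text \<open>A sum over an index type is an integral against counting measure, so Lebesgue's theorem
  applies. The limits behind the triple product, the Durfee identity and Euler's identity are all
  taken this way.\<close>

lemma infsum_dominated_convergence:
  fixes f :: "nat \<Rightarrow> 'a \<Rightarrow> complex"
  assumes bound: "\<And>n a. norm (f n a) \<le> g a" and g: "g summable_on UNIV"
    and lim: "\<And>a. (\<lambda>n. f n a) \<longlonglongrightarrow> l a"
  shows "(\<lambda>n. infsum (f n) UNIV) \<longlonglongrightarrow> infsum l UNIV"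
proof -
  have g0: "g a \<ge> 0" for a
    using bound[of 0 a] norm_ge_zero order_trans by blast
  have "(\<lambda>a. norm (g a)) summable_on UNIV"
    using g g0 by simp
  then have ig: "integrable (count_space UNIV) g"
    by (metis abs_summable_equivalent Infinite_Set_Sum.abs_summable_on_def)
  have le: "norm (l a) \<le> g a" for a
    by (rule Lim_bounded[OF tendsto_norm[OF lim]]) (use bound in auto)
  have to_int: "infsum u UNIV = integral\<^sup>L (count_space UNIV) u"
    if "\<And>a. norm (u a) \<le> g a" for u :: "'a \<Rightarrow> complex"
  proof -
    have "integrable (count_space UNIV) u"
      by (rule Bochner_Integration.integrable_bound[OF ig])
        (auto intro!: AE_I2 order_trans[OF that])
    then show ?thesis
      using infsetsum_infsum[of u UNIV]
      by (simp add: Infinite_Set_Sum.abs_summable_on_def infsetsum_def)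
  qed
  have "(\<lambda>n. integral\<^sup>L (count_space UNIV) (f n)) \<longlonglongrightarrow> integral\<^sup>L (count_space UNIV) l"
    by (rule integral_dominated_convergence[where w = g]) (use ig lim bound in auto)
  then show ?thesis
    using to_int bound le by simp
qed

text \<open>Two geometric series glued at 0. This is the common majorant of the sums over all
  integers.\<close>

lemma summable_power_abs_int:
  fixes \<rho> :: real
  assumes "0 \<le> \<rho>" "\<rho> < 1"
  shows "(\<lambda>r::int. \<rho> powi \<bar>r\<bar>) summable_on UNIV"
proof -
  have geo: "(\<lambda>n::nat. \<rho> ^ n) summable_on UNIV"
    by (rule norm_summable_imp_summable_on) (use assms in \<open>auto simp: norm_power summable_geometric\<close>)
  have 1: "(\<lambda>r::int. \<rho> powi \<bar>r\<bar>) summable_on {0..}"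
    using geo by (subst summable_on_reindex_bij_witness[of _ int nat UNIV "\<lambda>n. \<rho> ^ n"]) (auto simp: power_int_def)
  have "(\<lambda>r::int. \<rho> powi \<bar>r\<bar>) summable_on {..0}"
    using geo by (subst summable_on_reindex_bij_witness[of _ "\<lambda>n. - int n" "\<lambda>r. nat (-r)" UNIV "\<lambda>n. \<rho> ^ n"])
      (auto simp: power_int_def)
  \<comment> \<open>Dropping 0 makes the two halves disjoint.\<close>
  then have "(\<lambda>r::int. \<rho> powi \<bar>r\<bar>) summable_on {..<0}"
    by (rule summable_on_subset_banach) auto
  with 1 have "(\<lambda>r::int. \<rho> powi \<bar>r\<bar>) summable_on ({0..} \<union> {..<0})"
    by (intro summable_on_Un_disjoint) auto
  moreover have "{0..} \<union> {..<0} = (UNIV :: int set)" by auto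
  ultimately show ?thesis by simp
qed

lemma norm_power_int_le:
  fixes w :: complex
  assumes "norm w < 1" "0 \<le> m" "m \<le> n"
  shows "norm (w powi n) \<le> norm w powi m"
proof -
  have "norm w ^ nat n \<le> norm w ^ nat m"
    using assms by (intro power_decreasing) auto
  then show ?thesis
    using assms by (simp add: power_int_def norm_power)
qed

lemma summable_on_norm_bound:
  fixes f :: "'a \<Rightarrow> complex"
  assumes "g summable_on A" "\<And>x. x \<in> A \<Longrightarrow> norm (f x) \<le> g x"
  shows "f summable_on A"
  by (rule abs_summable_summable[OF Infinite_Sum.abs_summable_on_comparison_test'[OF assms]])

lemma infsum_diff_complex:
  fixes f g :: "'a \<Rightarrow> complex"
  assumes "f summable_on A" "g summable_on A"
  shows "(\<Sum>\<^sub>\<infinity>x\<in>A. f x - g x) = infsum f A - infsum g A"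
  using infsum_add[OF assms(1) summable_on_uminus[THEN iffD2, OF assms(2)]]
  by (simp add: infsum_uminus)

section \<open>Shifted factorials and their reciprocals\<close>

lemma qpoch_0 [simp]: "qpoch a x 0 = 1"
  by (simp add: qpoch_def)

lemma qpoch_Suc: "qpoch a x (Suc n) = qpoch a x n * (1 - a * x ^ n)"
  by (simp add: qpoch_def)

lemma qpoch_add: "qpoch a x (m + n) = qpoch a x m * qpoch (a * x ^ m) x n"
  by (induction n) (simp_all add: qpoch_Suc power_add mult_ac)

text \<open>Sort the factors \<open>1 - q ^ k\<close> by the parity of k.\<close>

lemma qpoch_double: "qpoch q q (2 * n) = qpoch q (q^2) n * qpoch (q^2) (q^2) n"
proof (induction n)
  case (Suc n)
  have "(q^2) ^ n = q ^ (2 * n)"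
    by (simp add: power_mult)
  then show ?case
    using Suc by (simp add: qpoch_Suc power2_eq_square mult_ac)
qed simp

lemma qpoch_tendsto:
  assumes "norm x < 1"
  shows "qpoch a x \<longlonglongrightarrow> qpoch_inf a x"
  using convergent_prod_LIMSEQ[OF qpoch_inf_convergent[OF assms, of a]]
  by (simp add: LIMSEQ_lessThan_iff_atMost[symmetric] qpoch_def[abs_def] qpoch_inf_def)

lemma one_minus_qpower_nonzero:
  fixes a x :: complex
  assumes "norm x < 1" "norm a < 1"
  shows "1 - a * x ^ k \<noteq> 0"
proof -
  have "norm (a * x ^ k) \<le> norm a * 1"
    unfolding norm_mult norm_power using assms by (intro mult_left_mono power_le_one) auto
  then show ?thesis
    using assms by (metis eq_iff_diff_eq_0 linorder_not_less mult.right_neutral norm_one order_trans)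
qed

lemma qpoch_nonzero:
  assumes "norm x < 1" "norm a < 1"
  shows "qpoch a x n \<noteq> 0"
  using one_minus_qpower_nonzero[OF assms] by (simp add: qpoch_def)

lemma qpoch_inf_nonzero:
  assumes "norm x < 1" "norm a < 1"
  shows "qpoch_inf a x \<noteq> 0"
  unfolding qpoch_inf_def
  by (rule prodinf_nonzero[OF qpoch_inf_convergent]) (use assms one_minus_qpower_nonzero in auto)

lemma qpoch_inf_shift:
  assumes "norm x < 1"
  shows "qpoch a x n * qpoch_inf (a * x ^ n) x = qpoch_inf a x"
proof (rule LIMSEQ_unique)
  show "(\<lambda>m. qpoch a x (n + m)) \<longlonglongrightarrow> qpoch a x n * qpoch_inf (a * x ^ n) x"
    unfolding qpoch_add by (intro tendsto_mult tendsto_const qpoch_tendsto assms)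
  show "(\<lambda>m. qpoch a x (n + m)) \<longlonglongrightarrow> qpoch_inf a x"
    using LIMSEQ_ignore_initial_segment[OF qpoch_tendsto[OF assms, of a], of n] by (simp add: add.commute)
qed

lemma qpoch_inf_double:
  assumes "norm q < 1"
  shows "qpoch_inf q q = qpoch_inf q (q^2) * qpoch_inf (q^2) (q^2)"
proof (rule LIMSEQ_unique)
  have q2: "norm (q^2) < 1"
    using assms by (simp add: norm_power power_less_one_iff)
  show "(\<lambda>n. qpoch q q (2 * n)) \<longlonglongrightarrow> qpoch_inf q (q^2) * qpoch_inf (q^2) (q^2)"
    unfolding qpoch_double by (intro tendsto_mult qpoch_tendsto q2)
  show "(\<lambda>n. qpoch q q (2 * n)) \<longlonglongrightarrow> qpoch_inf q q"
    using LIMSEQ_subseq_LIMSEQ[OF qpoch_tendsto[OF assms, of q], of "\<lambda>n. 2 * n"]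
    by (simp add: strict_mono_def o_def)
qed

section \<open>Reciprocal factorials at integer indices\<close>

definition rfac :: "complex \<Rightarrow> int \<Rightarrow> complex" where
  "rfac x k = (if k < 0 then 0 else 1 / qpoch x x (nat k))"

lemma rfac_neg [simp]: "k < 0 \<Longrightarrow> rfac x k = 0"
  by (simp add: rfac_def)

lemma rfac_0 [simp]: "rfac x 0 = 1"
  by (simp add: rfac_def)

lemma rfac_of_nat: "rfac x (int n) = 1 / qpoch x x n"
  by (simp add: rfac_def)

text \<open>Setting the reciprocal to zero at negative indices is consistent with this recurrence, because the
  factor \<open>1 - x powi k\<close> vanishes at \<open>k = 0\<close>. All summations can thus run over all integers.\<close>
lemma rfac_rec:
  assumes "norm x < 1"
  shows "rfac x (k - 1) = (1 - x powi k) * rfac x k"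
proof (cases "k \<le> 0")
  case True
  then show ?thesis by (cases "k = 0") auto
next
  case False
  then obtain n where k: "k = int (Suc n)"
    by (metis not_le zero_less_imp_eq_int old.nat.exhaust of_nat_0_less_iff less_not_refl)
  have nz: "1 - x * x ^ n \<noteq> 0"
    using one_minus_qpower_nonzero[OF assms assms] .
  have "x powi k = x * x ^ n"
    unfolding k power_int_of_nat by simp
  moreover have "rfac x k = 1 / (qpoch x x n * (1 - x * x ^ n))"
    unfolding k rfac_of_nat qpoch_Suc ..
  moreover have "rfac x (k - 1) = 1 / qpoch x x n"
    using k rfac_of_nat[of x n] by simp
  ultimately show ?thesis
    using nz by simp
qed

text \<open>The offset \<open>k\<close> covers both \<open>int n - r\<close> and
  \<open>int n + r\<close> in the triple product.\<close>

lemma rfac_tendsto: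
  assumes "norm x < 1"
  shows "(\<lambda>n. rfac x (int n + k)) \<longlonglongrightarrow> 1 / qpoch_inf x x"
proof -
  have "(\<lambda>n. 1 / qpoch x x n) \<longlonglongrightarrow> 1 / qpoch_inf x x"
    by (intro tendsto_divide tendsto_const qpoch_tendsto qpoch_inf_nonzero assms)
  moreover have "filterlim (\<lambda>n. nat (int n + k)) sequentially sequentially"
    by (rule filterlim_at_top_mono[of "\<lambda>n. n - nat (-k)"])
      (auto intro!: eventuallyI filterlim_minus_const_nat_at_top)
  ultimately have "(\<lambda>n. 1 / qpoch x x (nat (int n + k))) \<longlonglongrightarrow> 1 / qpoch_inf x x"
    by (rule filterlim_compose)
  moreover have "\<forall>\<^sub>F n in sequentially. 1 / qpoch x x (nat (int n + k)) = rfac x (int n + k)"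
    using eventually_ge_at_top[of "nat (-k)"] by eventually_elim (auto simp: rfac_def)
  ultimately show ?thesis
    by (rule Lim_transform_eventually)
qed

text \<open>The values converge along the naturals and vanish elsewhere. The constant enters the
  dominating series below.\<close>

lemma rfac_bounded:
  assumes "norm x < 1"
  obtains K where "K > 0" "\<And>k. norm (rfac x k) \<le> K"
proof -
  have "Bseq (\<lambda>n. rfac x (int n))"
    using rfac_tendsto[OF assms, of 0] by (auto intro: convergent_imp_Bseq convergentI)
  then obtain K where K: "K > 0" "\<And>n. norm (rfac x (int n)) \<le> K"
    by (auto elim: BseqE)
  have "norm (rfac x k) \<le> K" for k
    using K(1) K(2)[of "nat k"] by (cases "k < 0") auto
  with K(1) that show thesis by blast
qed

text \<open>Split \<open>1 - x powi (a + b)\<close> as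
  \<open>(1 - x powi b) + x powi b * (1 - x powi a)\<close>; by \<open>rfac_rec\<close> each bracket
  lowers one index.\<close>

lemma rfac_pascal:
  assumes "norm x < 1" "x \<noteq> 0"
  shows "(1 - x powi (a + b)) * (rfac x a * rfac x b)
    = rfac x a * rfac x (b - 1) + x powi b * (rfac x (a - 1) * rfac x b)"
  using assms by (simp add: rfac_rec power_int_add algebra_simps)

section \<open>Bilateral sums and the Jacobi triple product\<close>

text \<open>
  With \<open>x = w powi h\<close>, the product of the two reciprocal factorials is the Gaussian binomial
  coefficient of \<open>a + b\<close> over \<open>a - r\<close> in base \<open>x\<close>, divided by \<open>(x; x)\<close> of length \<open>a + b\<close>.
  Working with a square root \<open>w\<close> of \<open>q\<close> turns the exponents \<open>r (3 r \<plusminus> 1) / 2\<close> and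
  \<open>r (7 r \<plusminus> 1) / 2\<close> into integral polynomials.
\<close>

definition bilat_term :: "complex \<Rightarrow> int \<Rightarrow> int \<Rightarrow> int \<Rightarrow> int \<Rightarrow> int \<Rightarrow> int \<Rightarrow> complex" where
  "bilat_term w h d c a b r = (-1) powi r * w powi (d * r^2 + c * r)
    * (rfac (w powi h) (a - r) * rfac (w powi h) (b + r))"

definition bilat :: "complex \<Rightarrow> int \<Rightarrow> int \<Rightarrow> int \<Rightarrow> int \<Rightarrow> int \<Rightarrow> complex" where
  "bilat w h d c a b = (\<Sum>\<^sub>\<infinity>r. bilat_term w h d c a b r)"

definition theta :: "complex \<Rightarrow> int \<Rightarrow> int \<Rightarrow> complex" where
  "theta w d c = (\<Sum>\<^sub>\<infinity>r::int. (-1) powi r * w powi (d * r^2 + c * r))"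

lemma bilat_term_eq_0: "r \<notin> {-b..a} \<Longrightarrow> bilat_term w h d c a b r = 0"
  by (auto simp: bilat_term_def)

lemma bilat_term_summable: "bilat_term w h d c a b summable_on UNIV"
  using has_sum_finite_neutralI[of "{-b..a}" UNIV "bilat_term w h d c a b"] bilat_term_eq_0
  by (auto simp: summable_on_def)

lemma bilat_neg: "a + b < 0 \<Longrightarrow> bilat w h d c a b = 0"
  unfolding bilat_def by (rule infsum_0) (auto intro: bilat_term_eq_0)

lemma bilat_0: "bilat w h d c 0 0 = 1"
proof -
  have "infsum (bilat_term w h d c 0 0) UNIV = infsum (bilat_term w h d c 0 0) {0}"
    by (rule infsum_cong_neutral) (auto intro: bilat_term_eq_0)
  then show ?thesis
    by (simp only: bilat_def) (simp add: bilat_term_def)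
qed

text \<open>Replace r by -r, which leaves the sign \<open>(-1) powi r\<close> unchanged.\<close>

lemma bilat_reflect: "bilat w h d c a b = bilat w h d (-c) b a"
  unfolding bilat_def
  by (rule infsum_reindex_bij_witness[of _ uminus uminus])
    (auto simp: bilat_term_def power_int_minus mult_ac simp flip: power_int_inverse)

context
  fixes w :: complex
  assumes w_nonzero: "w \<noteq> 0" and norm_w: "norm w < 1"
begin

lemma norm_powi_less_1: "h > 0 \<Longrightarrow> norm (w powi h) < 1"
  using norm_w by (simp add: power_int_def norm_power power_less_one_iff)

lemma w_powi_eq:
  assumes "a + b = c + d"
  shows "w powi a * w powi b = w powi c * w powi d"
  using assms w_nonzero by (simp flip: power_int_add)

text \<open>\<open>rfac_pascal\<close> applies termwise because the indices \<open>a - r\<close> and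
  \<open>b + r\<close> have a sum free of r. The r-dependent part of the extra power
  \<open>w powi (h * (b + r))\<close> raises the linear coefficient from \<open>c\<close> to
  \<open>c + h\<close>.\<close>

lemma bilat_pascal:
  assumes h: "h > 0"
  shows "(1 - w powi (h * (a + b))) * bilat w h d c a b
    = bilat w h d c a (b - 1) + w powi (h * b) * bilat w h d (c + h) (a - 1) b"
proof -
  have "(1 - w powi (h * (a + b))) * bilat_term w h d c a b r
      = bilat_term w h d c a (b - 1) r + w powi (h * b) * bilat_term w h d (c + h) (a - 1) b r" for r
  proof -
    let ?x = "w powi h"
    have exponent: "w powi (d * r^2 + c * r) * w powi (h * (b + r))
        = w powi (h * b) * w powi (d * r^2 + (c + h) * r)"
      by (rule w_powi_eq) (simp add: algebra_simps)
    have pascal: "(1 - w powi (h * (a + b))) * (rfac ?x (a - r) * rfac ?x (b + r))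
      = rfac ?x (a - r) * rfac ?x (b - 1 + r)
        + w powi (h * (b + r)) * (rfac ?x (a - 1 - r) * rfac ?x (b + r))"
    proof -
      have eqs: "a - r + (b + r) = a + b" "b + r - 1 = b - 1 + r" "a - r - 1 = a - 1 - r"
        by simp_all
      show ?thesis
        using rfac_pascal[OF norm_powi_less_1[OF h], of "a - r" "b + r", unfolded eqs] w_nonzero
        by (simp add: power_int_mult)
    qed
    have "(1 - w powi (h * (a + b))) * bilat_term w h d c a b r
      = (-1) powi r * w powi (d * r^2 + c * r)
         * ((1 - w powi (h * (a + b))) * (rfac ?x (a - r) * rfac ?x (b + r)))"
      by (simp add: bilat_term_def)
    also have "\<dots> = bilat_term w h d c a (b - 1) r
        + (-1) powi r * (w powi (d * r^2 + c * r) * w powi (h * (b + r)))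
          * (rfac ?x (a - 1 - r) * rfac ?x (b + r))"
      unfolding pascal by (simp add: bilat_term_def algebra_simps)
    finally show ?thesis
      unfolding exponent by (simp add: bilat_term_def)
  qed
  then have "(\<Sum>\<^sub>\<infinity>r. (1 - w powi (h * (a + b))) * bilat_term w h d c a b r)
    = (\<Sum>\<^sub>\<infinity>r. bilat_term w h d c a (b - 1) r + w powi (h * b) * bilat_term w h d (c + h) (a - 1) b r)"
    by simp
  then show ?thesis
    unfolding bilat_def
    by (simp add: infsum_add bilat_term_summable summable_on_cmult_right infsum_cmult_right')
qed

text \<open>Replace r by r + 1: expanding the quadratic exponent leaves the constant
  \<open>d + c\<close>, and the alternating sign flips.\<close>

lemma bilat_shift:
  "bilat w h d c a b = - (w powi (d + c)) * bilat w h d (c + 2 * d) (a - 1) (b + 1)"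
proof -
  have "bilat_term w h d c a b (r + 1)
      = - (w powi (d + c)) * bilat_term w h d (c + 2 * d) (a - 1) (b + 1) r" for r
  proof -
    have exponent: "w powi (d * (r + 1)^2 + c * (r + 1))
        = w powi (d + c) * w powi (d * r^2 + (c + 2 * d) * r)"
      using w_nonzero by (simp flip: power_int_add add: algebra_simps power2_eq_square)
    have eqs: "a - (r + 1) = a - 1 - r" "b + (r + 1) = b + 1 + r"
      by simp_all
    have sign: "(-1 :: complex) powi (r + 1) = - ((-1) powi r)"
      by (simp add: power_int_add)
    show ?thesis
      unfolding bilat_term_def exponent eqs sign by (simp add: mult_ac)
  qed
  moreover have "infsum (bilat_term w h d c a b) UNIV = (\<Sum>\<^sub>\<infinity>r. bilat_term w h d c a b (r + 1))"
    by (rule infsum_reindex_bij_witness[of _ "\<lambda>r. r + 1" "\<lambda>r. r - 1"]) auto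
  ultimately show ?thesis
    unfolding bilat_def by (simp add: infsum_uminus infsum_cmult_right')
qed

text \<open>
  For \<open>h = 2 * d\<close> the shifted sum produced by the q-Pascal rule is the one produced by translating
  the summation index, so the recurrence closes up on a single family.
\<close>

lemma bilat_triple_step:
  assumes d: "d > 0"
  shows "(1 - w powi (2 * d * (a + b))) * bilat w (2 * d) d c a b
    = (1 - w powi (2 * d * b - d - c)) * bilat w (2 * d) d c a (b - 1)"
proof -
  let ?T = "bilat w (2 * d) d (c + 2 * d) (a - 1) b"
  have "w powi (2 * d * b - d - c) * w powi (d + c) = w powi (2 * d * b) * w powi 0"
    by (rule w_powi_eq) simp
  moreover have "bilat w (2 * d) d c a (b - 1) = - (w powi (d + c)) * ?T"
    using bilat_shift[of "2 * d" d c a "b - 1"] by simp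
  ultimately have "w powi (2 * d * b) * ?T = - (w powi (2 * d * b - d - c)) * bilat w (2 * d) d c a (b - 1)"
    by (simp flip: mult.assoc)
  then show ?thesis
    using bilat_pascal[of "2 * d" a b d c] d by (simp add: algebra_simps)
qed

lemma qpoch_powi_Suc:
  "qpoch (w powi a) (w powi h) (Suc n) = qpoch (w powi a) (w powi h) n * (1 - w powi (a + h * int n))"
  using w_nonzero by (simp add: qpoch_Suc power_int_add power_int_mult)

lemma finite_triple_product:
  assumes d: "d > 0"
  shows "qpoch (w powi (2 * d)) (w powi (2 * d)) (2 * n) * bilat w (2 * d) d c (int n) (int n)
    = qpoch (w powi (d - c)) (w powi (2 * d)) n * qpoch (w powi (d + c)) (w powi (2 * d)) n"
proof (induction n)
  case (Suc n)
  let ?x = "w powi (2 * d)"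
  let ?T = "\<lambda>a b. bilat w (2 * d) d c a b"
  define A B C D where "A = 1 - w powi (2 * d * (2 * int n + 1))"
    and "B = 1 - w powi (d + c + 2 * d * int n)"
    and "C = 1 - w powi (2 * d * (2 * int n + 2))"
    and "D = 1 - w powi (d - c + 2 * d * int n)"
  note coeffs = A_def B_def C_def D_def
  \<comment> \<open>\<open>bilat_triple_step\<close> raises the second index only; reflecting first,
    hence with \<open>-c\<close>, raises the first one.\<close>
  have 1: "A * ?T (int n + 1) (int n) = B * ?T (int n) (int n)"
    using bilat_triple_step[OF d, of "int n" "int n + 1" "-c"]
    by (simp add: bilat_reflect[of w _ _ "-c"] coeffs algebra_simps)
  have 2: "C * ?T (int n + 1) (int n + 1) = D * ?T (int n + 1) (int n)"
    using bilat_triple_step[OF d, of "int n + 1" "int n + 1" c] by (simp add: coeffs algebra_simps)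
  have "qpoch ?x ?x (2 * Suc n) * ?T (int (Suc n)) (int (Suc n))
      = qpoch ?x ?x (2 * n) * (A * (C * ?T (int n + 1) (int n + 1)))"
    by (simp add: qpoch_powi_Suc coeffs algebra_simps)
  also have "\<dots> = B * D * (qpoch ?x ?x (2 * n) * ?T (int n) (int n))"
    using 1 unfolding 2 by (simp add: mult_ac)
  also have "\<dots> = qpoch (w powi (d - c)) ?x (Suc n) * qpoch (w powi (d + c)) ?x (Suc n)"
    unfolding Suc.IH by (simp add: qpoch_powi_Suc coeffs mult_ac)
  finally show ?case .
qed (simp add: bilat_0)

text \<open>Since r^2 is at least the absolute value of r, the exponent is at least
  \<open>(d - \<bar>c\<bar>) * r^2\<close>, and the first factor is a positive integer.\<close>

lemma norm_theta_term_le: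
  assumes d: "\<bar>c\<bar> < d"
  shows "norm ((-1) powi r * w powi (d * r^2 + c * r)) \<le> norm w powi \<bar>r\<bar>"
proof -
  have "\<bar>r\<bar> \<le> \<bar>r\<bar> * \<bar>r\<bar>"
    using mult_right_mono[of 1 "\<bar>r\<bar>" "\<bar>r\<bar>"] by (cases "r = 0") auto
  then have "\<bar>r\<bar> \<le> (d - \<bar>c\<bar>) * r^2"
    using d mult_mono[of 1 "d - \<bar>c\<bar>" "\<bar>r\<bar>" "r^2"] by (simp add: power2_eq_square)
  moreover have "- (c * r) \<le> \<bar>c\<bar> * r^2"
    using \<open>\<bar>r\<bar> \<le> \<bar>r\<bar> * \<bar>r\<bar>\<close> abs_ge_minus_self[of "c * r"] mult_left_mono[of "\<bar>r\<bar>" "r^2" "\<bar>c\<bar>"]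
    by (simp add: abs_mult power2_eq_square)
  ultimately have "\<bar>r\<bar> \<le> d * r^2 + c * r"
    by (simp add: algebra_simps)
  then have "norm (w powi (d * r^2 + c * r)) \<le> norm w powi \<bar>r\<bar>"
    by (intro norm_power_int_le norm_w) auto
  then show ?thesis
    by (simp add: norm_mult norm_power_int)
qed

text \<open>Let n grow in \<open>finite_triple_product\<close>. Both reciprocal factorials tend to
  the reciprocal of the same infinite product, and the factor of length \<open>2 * n\<close> cancels
  one of them.\<close>

lemma jacobi_triple_product:
  assumes d: "\<bar>c\<bar> < d"
  shows "theta w d c
    = qpoch_inf (w powi (d - c)) (w powi (2 * d)) * qpoch_inf (w powi (d + c)) (w powi (2 * d))
      * qpoch_inf (w powi (2 * d)) (w powi (2 * d))"
proof -
  let ?x = "w powi (2 * d)"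
  have d0: "d > 0" using d by simp
  have x: "norm ?x < 1"
    using norm_powi_less_1 d0 by simp
  obtain K where K: "K > 0" "\<And>k. norm (rfac ?x k) \<le> K"
    using rfac_bounded[OF x] by blast
  have lim_rfac: "(\<lambda>n. rfac ?x (int n + r)) \<longlonglongrightarrow> 1 / qpoch_inf ?x ?x" for r
    by (rule rfac_tendsto[OF x])
  have "(\<lambda>n. bilat w (2 * d) d c (int n) (int n)) \<longlonglongrightarrow> (\<Sum>\<^sub>\<infinity>r::int. (-1) powi r * w powi (d * r^2 + c * r)
      * (1 / qpoch_inf ?x ?x * (1 / qpoch_inf ?x ?x)))"
    unfolding bilat_def
  proof (rule infsum_dominated_convergence)
    show "(\<lambda>r. norm w powi \<bar>r\<bar> * (K * K)) summable_on (UNIV :: int set)"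
      by (intro summable_on_cmult_left summable_power_abs_int) (use norm_w in auto)
    show "norm (bilat_term w (2 * d) d c (int n) (int n) r) \<le> norm w powi \<bar>r\<bar> * (K * K)" for n r
      unfolding bilat_term_def norm_mult[of "_ * _" "_ * _"]
      by (intro mult_mono norm_theta_term_le d) (use K in \<open>auto simp: norm_mult intro!: mult_mono\<close>)
    show "(\<lambda>n. bilat_term w (2 * d) d c (int n) (int n) r) \<longlonglongrightarrow> (-1) powi r * w powi (d * r^2 + c * r)
      * (1 / qpoch_inf ?x ?x * (1 / qpoch_inf ?x ?x))" for r
      unfolding bilat_term_def
      by (intro tendsto_mult tendsto_const lim_rfac) (use lim_rfac[of "-r"] in simp)
  qed
  then have lim: "(\<lambda>n. bilat w (2 * d) d c (int n) (int n)) \<longlonglongrightarrow>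
      theta w d c * (1 / qpoch_inf ?x ?x * (1 / qpoch_inf ?x ?x))"
    by (simp only: infsum_cmult_left' theta_def)
  have "(\<lambda>n. qpoch ?x ?x (2 * n)) \<longlonglongrightarrow> qpoch_inf ?x ?x"
    using LIMSEQ_subseq_LIMSEQ[OF qpoch_tendsto[OF x, of ?x], of "\<lambda>n. 2 * n"]
    by (simp add: strict_mono_def o_def)
  from tendsto_mult[OF this lim]
  have "(\<lambda>n. qpoch (w powi (d - c)) ?x n * qpoch (w powi (d + c)) ?x n) \<longlonglongrightarrow>
      qpoch_inf ?x ?x * (theta w d c * (1 / qpoch_inf ?x ?x * (1 / qpoch_inf ?x ?x)))"
    by (simp add: finite_triple_product d0)
  moreover have "(\<lambda>n. qpoch (w powi (d - c)) ?x n * qpoch (w powi (d + c)) ?x n) \<longlonglongrightarrow>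
      qpoch_inf (w powi (d - c)) ?x * qpoch_inf (w powi (d + c)) ?x"
    by (intro tendsto_mult qpoch_tendsto x)
  ultimately have "qpoch_inf (w powi (d - c)) ?x * qpoch_inf (w powi (d + c)) ?x
      = qpoch_inf ?x ?x * (theta w d c * (1 / qpoch_inf ?x ?x * (1 / qpoch_inf ?x ?x)))"
    using LIMSEQ_unique by blast
  then show ?thesis
    using qpoch_inf_nonzero[OF x x] by (simp add: field_simps)
qed

end

section \<open>The Durfee rectangle identity and Euler's identity\<close>

text \<open>The generating function of partitions whose Durfee rectangle has sides m and m +
  k.\<close>

definition durfee_term :: "complex \<Rightarrow> int \<Rightarrow> int \<Rightarrow> complex" where
  "durfee_term x k m = x powi (m * (m + k)) * (rfac x m * rfac x (m + k))"

definition durfee :: "complex \<Rightarrow> int \<Rightarrow> complex" where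
  "durfee x k = (\<Sum>\<^sub>\<infinity>m. durfee_term x k m)"

lemma durfee_reflect: "durfee x k = durfee x (- k)"
  unfolding durfee_def
  by (rule infsum_reindex_bij_witness[of _ "\<lambda>m. m - k" "\<lambda>m. m + k"])
    (auto simp: durfee_term_def mult_ac)

context
  fixes x :: complex
  assumes x_nonzero: "x \<noteq> 0" and norm_x: "norm x < 1"
begin

text \<open>The bound is uniform in k, as needed for the limit in k. For nonnegative k and m the
  exponent \<open>m * (m + k)\<close> is at least m; for negative m the term is zero.\<close>

lemma durfee_term_bound:
  obtains K where "\<And>k m. k \<ge> 0 \<Longrightarrow> norm (durfee_term x k m) \<le> norm x powi \<bar>m\<bar> * K"
proof -
  obtain K where K: "K > 0" "\<And>k. norm (rfac x k) \<le> K"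
    using rfac_bounded[OF norm_x] by blast
  have "norm (durfee_term x k m) \<le> norm x powi \<bar>m\<bar> * (K * K)" if "k \<ge> 0" for k m
  proof (cases "m \<ge> 0")
    case True
    have "m * 1 \<le> m * (m + k)" if "m > 0"
      using \<open>k \<ge> 0\<close> that by (intro mult_left_mono) auto
    then have "\<bar>m\<bar> \<le> m * (m + k)"
      using True by (cases "m = 0") auto
    then have "norm (x powi (m * (m + k))) \<le> norm x powi \<bar>m\<bar>"
      by (intro norm_power_int_le norm_x) auto
    moreover have "norm (rfac x m * rfac x (m + k)) \<le> K * K"
      unfolding norm_mult by (intro mult_mono) (use K in \<open>auto intro: less_imp_le\<close>)
    ultimately show ?thesis
      unfolding durfee_term_def norm_mult[of "_ powi _"] by (intro mult_mono) auto
  next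
    case False
    then show ?thesis
      using K(1) by (simp add: durfee_term_def)
  qed
  with that show thesis by blast
qed

lemma durfee_term_summable:
  assumes "k \<ge> 0"
  shows "durfee_term x k summable_on UNIV"
proof -
  obtain K where K: "\<And>k m. k \<ge> 0 \<Longrightarrow> norm (durfee_term x k m) \<le> norm x powi \<bar>m\<bar> * K"
    using durfee_term_bound by blast
  show ?thesis
  proof (rule summable_on_norm_bound)
    show "(\<lambda>m. norm x powi \<bar>m\<bar> * K) summable_on (UNIV :: int set)"
      by (intro summable_on_cmult_left summable_power_abs_int) (use norm_x in auto)
  qed (use K assms in auto)
qed

text \<open>Only m = 0 survives: for positive m the term carries the factor
  \<open>(x powi m) ^ n\<close>.\<close>

lemma durfee_tendsto: "(\<lambda>n. durfee x (int n)) \<longlonglongrightarrow> 1 / qpoch_inf x x"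
proof -
  obtain K where K: "\<And>k m. k \<ge> 0 \<Longrightarrow> norm (durfee_term x k m) \<le> norm x powi \<bar>m\<bar> * K"
    using durfee_term_bound by blast
  define l where "l = (\<lambda>m::int. if m = 0 then 1 / qpoch_inf x x else 0)"
  have "(\<lambda>n. durfee x (int n)) \<longlonglongrightarrow> infsum l UNIV"
    unfolding durfee_def
  proof (rule infsum_dominated_convergence)
    show "(\<lambda>m. norm x powi \<bar>m\<bar> * K) summable_on (UNIV :: int set)"
      by (intro summable_on_cmult_left summable_power_abs_int) (use norm_x in auto)
    show "norm (durfee_term x (int n) m) \<le> norm x powi \<bar>m\<bar> * K" for n m
      using K by simp
    show "(\<lambda>n. durfee_term x (int n) m) \<longlonglongrightarrow> l m" for m
    proof -
      have rfac_lim: "(\<lambda>n. rfac x (m + int n)) \<longlonglongrightarrow> 1 / qpoch_inf x x"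
        using rfac_tendsto[OF norm_x, of m] by (simp add: add.commute)
      consider "m < 0" | "m = 0" | "m > 0" by linarith
      then show ?thesis
      proof cases
        case 3
        have eq: "durfee_term x (int n) m
            = x powi (m * m) * (x powi m) ^ n * (rfac x m * rfac x (m + int n))" for n
          using x_nonzero by (simp add: durfee_term_def distrib_left power_int_add power_int_mult)
        have "norm (x powi m) < 1"
          using 3 norm_x by (simp add: power_int_def norm_power power_less_one_iff)
        then have "(\<lambda>n. (x powi m) ^ n) \<longlonglongrightarrow> 0"
          by (rule LIMSEQ_power_zero)
        then have "(\<lambda>n. durfee_term x (int n) m) \<longlonglongrightarrow>
            x powi (m * m) * 0 * (rfac x m * (1 / qpoch_inf x x))"
          unfolding eq by (intro tendsto_mult tendsto_const rfac_lim)
        then show ?thesis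
          using 3 by (simp add: l_def)
      qed (use rfac_lim in \<open>auto simp: l_def durfee_term_def\<close>)
    qed
  qed
  moreover have "infsum l UNIV = infsum l {0}"
    by (rule infsum_cong_neutral) (auto simp: l_def)
  ultimately show ?thesis
    by (simp add: l_def)
qed

text \<open>With M and N as in the proof, this is \<open>1 - M * N = M + (1 - M) - N * M\<close>.
  The bracket \<open>1 - M\<close> lowers m, and N compensates the exponent because (m - 1)(m + k +
  1) + (k + 1) = m(m + k).\<close>

lemma durfee_term_rec:
  "durfee_term x k m = durfee_term x (k + 1) m
    + (x powi (k + 1) * durfee_term x (k + 2) (m - 1) - x powi (k + 1) * durfee_term x (k + 1) m)"
proof -
  define P M r s where "P = x powi (m * (m + k))" and "M = x powi m"
    and "r = rfac x m" and "s = rfac x (m + k + 1)"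
  define N where "N = x powi (k + 1)"
  have "rfac x (m + k) = (1 - M * N) * s"
    using rfac_rec[OF norm_x, of "m + k + 1"] x_nonzero
    by (simp add: M_def N_def s_def flip: power_int_add add: algebra_simps)
  then have 1: "durfee_term x k m = P * (r * ((1 - M * N) * s))"
    by (simp add: durfee_term_def P_def r_def)
  have "x powi (m * (m + (k + 1))) = P * M"
    using x_nonzero by (simp add: P_def M_def flip: power_int_add add: algebra_simps)
  then have 2: "durfee_term x (k + 1) m = P * M * (r * s)"
    by (simp add: durfee_term_def r_def s_def add.assoc)
  have "N * x powi ((m - 1) * (m - 1 + (k + 2))) = P"
    using x_nonzero by (simp add: P_def N_def flip: power_int_add add: algebra_simps)
  moreover have "rfac x (m - 1) = (1 - M) * r"
    by (simp add: rfac_rec[OF norm_x] M_def r_def)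
  moreover have "rfac x (m - 1 + (k + 2)) = s"
    by (simp add: s_def algebra_simps)
  ultimately have 3: "N * durfee_term x (k + 2) (m - 1) = P * ((1 - M) * r * s)"
    unfolding durfee_term_def by (simp flip: mult.assoc)
  show ?thesis
    unfolding N_def[symmetric] 1 2 3 by (simp add: algebra_simps)
qed

text \<open>Sum \<open>durfee_term_rec\<close> over m and undo the translation of m. Written in
  consecutive differences, so that their norms can be compared.\<close>

lemma durfee_rec:
  assumes "k \<ge> 0"
  shows "durfee x k - durfee x (k + 1) = - (x powi (k + 1)) * (durfee x (k + 1) - durfee x (k + 2))"
proof -
  let ?N = "x powi (k + 1)"
  have shift: "(\<lambda>m. durfee_term x (k + 2) (m - 1)) summable_on UNIV"
    "(\<Sum>\<^sub>\<infinity>m. durfee_term x (k + 2) (m - 1)) = durfee x (k + 2)"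
    using durfee_term_summable[of "k + 2"] assms unfolding durfee_def
    by (subst summable_on_reindex_bij_witness[of _ "\<lambda>m. m + 1" "\<lambda>m. m - 1" UNIV "durfee_term x (k + 2)"],
        auto intro: infsum_reindex_bij_witness[of _ "\<lambda>m. m + 1" "\<lambda>m. m - 1"])
  have "durfee x k = (\<Sum>\<^sub>\<infinity>m. durfee_term x (k + 1) m
      + (?N * durfee_term x (k + 2) (m - 1) - ?N * durfee_term x (k + 1) m))"
    unfolding durfee_def by (rule infsum_cong) (rule durfee_term_rec)
  also have "\<dots> = durfee x (k + 1) + (?N * durfee x (k + 2) - ?N * durfee x (k + 1))"
  proof -
    have summ: "(\<lambda>m. ?N * durfee_term x (k + 2) (m - 1)) summable_on UNIV"
      "(\<lambda>m. ?N * durfee_term x (k + 1) m) summable_on UNIV"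
      using shift durfee_term_summable assms by (auto intro: summable_on_cmult_right)
    have "(\<lambda>m. ?N * durfee_term x (k + 2) (m - 1) - ?N * durfee_term x (k + 1) m) summable_on UNIV"
      using summable_on_add[OF summ(1) summable_on_uminus[THEN iffD2, OF summ(2)]] by simp
    then show ?thesis
      using durfee_term_summable[of "k + 1"] assms shift(2)
      by (simp add: infsum_add infsum_diff_complex summ infsum_cmult_right' flip: durfee_def)
  qed
  finally show ?thesis
    by (simp add: algebra_simps)
qed

text \<open>
  The consecutive differences do not decrease in norm as \<open>k\<close> grows, but they tend to zero, so
  they all vanish.
\<close>

lemma durfee_nonneg_eq:
  assumes "k \<ge> 0"
  shows "durfee x k = 1 / qpoch_inf x x"
proof -
  define D where "D n = durfee x (k + int n) - durfee x (k + int n + 1)" for n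
  have lim: "(\<lambda>n. durfee x (k + int n)) \<longlonglongrightarrow> 1 / qpoch_inf x x"
    using LIMSEQ_ignore_initial_segment[OF durfee_tendsto, of "nat k"] assms by (simp add: add.commute)
  have "D \<longlonglongrightarrow> 1 / qpoch_inf x x - 1 / qpoch_inf x x"
    unfolding D_def using LIMSEQ_Suc[OF lim] by (intro tendsto_diff lim) (simp add: ac_simps)
  then have D0: "(\<lambda>n. norm (D n)) \<longlonglongrightarrow> 0"
    using tendsto_norm_zero by simp
  have "norm (D n) \<le> norm (D (Suc n))" for n
  proof -
    have "D n = - (x powi (k + int n + 1)) * D (Suc n)"
      using durfee_rec[of "k + int n"] assms by (simp add: D_def algebra_simps)
    moreover have "norm (x powi (k + int n + 1)) \<le> norm x powi 0"
      using assms by (intro norm_power_int_le norm_x) auto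
    ultimately show ?thesis
      by (simp add: norm_mult mult_left_le_one_le)
  qed
  then have "incseq (\<lambda>n. norm (D n))"
    by (rule incseq_SucI)
  then have "norm (D n) \<le> 0" for n
    using D0 incseq_le by blast
  then have "durfee x (k + int n + 1) = durfee x (k + int n)" for n
    by (simp add: D_def)
  then have "durfee x (k + int (Suc n)) = durfee x (k + int n)" for n
    by (simp add: add.commute add.left_commute)
  then have "durfee x (k + int n) = durfee x k" for n
    by (induction n) simp_all
  with lim have "(\<lambda>n::nat. durfee x k) \<longlonglongrightarrow> 1 / qpoch_inf x x"
    by simp
  then show ?thesis
    using LIMSEQ_unique[OF tendsto_const] by blast
qed

lemma durfee_eq: "durfee x k = 1 / qpoch_inf x x"
  using durfee_nonneg_eq[of k] durfee_nonneg_eq[of "-k"] durfee_reflect[of x k] by (cases "k \<ge> 0") auto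

end

text \<open>The series f satisfies f(y x) = (1 - y) f(y). Iterating gives f(z x^n) =
  \<open>qpoch z x n\<close> f(z), and the left side tends to f(0) = 1.\<close>

lemma euler_infsum:
  assumes x: "norm x < 1" and z: "norm z < 1"
  shows "(\<Sum>\<^sub>\<infinity>j. z ^ j / qpoch x x j) = 1 / qpoch_inf z x"
proof -
  obtain K where K: "K > 0" "\<And>k. norm (rfac x k) \<le> K"
    using rfac_bounded[OF x] by blast
  have geo: "(\<lambda>j. norm z ^ j * K) summable_on UNIV"
    by (intro summable_on_cmult_left norm_summable_imp_summable_on)
      (use z in \<open>auto simp: norm_power summable_geometric\<close>)
  have bound: "norm (y ^ j / qpoch x x j) \<le> norm z ^ j * K" if "norm y \<le> norm z" for y j
  proof -
    have "norm (y ^ j * rfac x (int j)) \<le> norm z ^ j * K"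
      unfolding norm_mult norm_power using K that by (intro mult_mono power_mono) auto
    then show ?thesis
      by (simp add: rfac_of_nat)
  qed
  define f where "f y = (\<Sum>\<^sub>\<infinity>j. y ^ j / qpoch x x j)" for y
  have summ: "(\<lambda>j. y ^ j / qpoch x x j) summable_on UNIV" if "norm y \<le> norm z" for y
    by (rule summable_on_norm_bound[OF geo]) (use bound that in auto)
  have step: "f (y * x) = (1 - y) * f y" if y: "norm y \<le> norm z" for y
  proof -
    have yx: "norm (y * x) \<le> norm z"
      using mult_mono[OF y, of "norm x" 1] x by (simp add: norm_mult)
    define u where "u j = y ^ j / qpoch x x j - (y * x) ^ j / qpoch x x j" for j
    \<comment> \<open>The difference contributes \<open>1 - x ^ Suc j\<close>, which is the last
      factor of the denominator.\<close>
    have u_Suc: "u (Suc j) = y * (y ^ j / qpoch x x j)" for j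
    proof -
      have "u (Suc j) = y ^ Suc j * (1 - x * x ^ j) / (qpoch x x j * (1 - x * x ^ j))"
        by (simp add: u_def qpoch_Suc power_mult_distrib right_diff_distrib diff_divide_distrib mult_ac)
      then show ?thesis
        using one_minus_qpower_nonzero[OF x x, of j] by simp
    qed
    have u_0: "u j = 0" if "j \<notin> range Suc" for j
      using that by (cases j) (auto simp: u_def)
    have "f y - f (y * x) = infsum u UNIV"
      unfolding f_def u_def by (rule infsum_diff_complex[symmetric]) (use summ y yx in auto)
    also have "\<dots> = infsum u (range Suc)"
      by (rule infsum_cong_neutral) (use u_0 in auto)
    also have "\<dots> = (\<Sum>\<^sub>\<infinity>j. y * (y ^ j / qpoch x x j))"
      by (subst infsum_reindex) (auto simp: u_Suc o_def)
    also have "\<dots> = y * f y"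
      unfolding f_def by (rule infsum_cmult_right')
    finally show ?thesis
      by (simp add: algebra_simps)
  qed
  have norm_zx: "norm (z * x ^ n) \<le> norm z" for n
    unfolding norm_mult norm_power using x by (intro mult_left_le power_le_one) auto
  have iter: "f (z * x ^ n) = qpoch z x n * f z" for n
  proof (induction n)
    case (Suc n)
    have "f (z * x ^ Suc n) = (1 - z * x ^ n) * f (z * x ^ n)"
      using step[OF norm_zx, of n] by (simp add: mult_ac)
    then show ?case
      unfolding Suc.IH by (simp add: qpoch_Suc)
  qed simp
  define l where "l = (\<lambda>j::nat. if j = 0 then 1 else 0 :: complex)"
  have "(\<lambda>n. f (z * x ^ n)) \<longlonglongrightarrow> infsum l UNIV"
    unfolding f_def
  proof (rule infsum_dominated_convergence)
    show "norm ((z * x ^ n) ^ j / qpoch x x j) \<le> norm z ^ j * K" for n j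
      by (rule bound[OF norm_zx])
    show "(\<lambda>n. (z * x ^ n) ^ j / qpoch x x j) \<longlonglongrightarrow> l j" for j
    proof -
      have "(\<lambda>n. (z * x ^ n) ^ j / qpoch x x j) \<longlonglongrightarrow> (z * 0) ^ j / qpoch x x j"
        by (intro tendsto_intros LIMSEQ_power_zero x qpoch_nonzero)
      then show ?thesis
        by (cases "j = 0") (auto simp: l_def power_0_left)
    qed
  qed (rule geo)
  moreover have "infsum l UNIV = infsum l {0}"
    by (rule infsum_cong_neutral) (auto simp: l_def)
  moreover have "(\<lambda>n. qpoch z x n * f z) \<longlonglongrightarrow> qpoch_inf z x * f z"
    by (intro tendsto_mult tendsto_const qpoch_tendsto x)
  ultimately have "qpoch_inf z x * f z = 1"
    unfolding iter using LIMSEQ_unique[of "\<lambda>n. qpoch z x n * f z"] by (simp add: l_def)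
  then show ?thesis
    using qpoch_inf_nonzero[OF x z] by (simp add: f_def field_simps)
qed

section \<open>The Bailey pairs\<close>

context
  fixes w :: complex
  assumes w_nonzero: "w \<noteq> 0" and norm_w: "norm w < 1"
begin

lemma one_minus_w_powi_nonzero: "k > 0 \<Longrightarrow> 1 - w powi k \<noteq> 0"
  using norm_powi_less_1[OF w_nonzero norm_w, of k] by auto

text \<open>Reflection and translation of the summation index together map this sum to its negative.\<close>

lemma bilat_4_3_vanish: "bilat w 4 3 3 n (n + 1) = 0"
  using bilat_shift[OF w_nonzero norm_w, of 4 3 "-3" "n + 1" n] bilat_reflect[of w 4 3 3 n "n + 1"]
  by simp

text \<open>Reflection and translation turn the central sum into the very sum with linear
  coefficient 5 that the q-Pascal rule produces, so the rule closes up.\<close>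

lemma bilat_4_3_odd:
  "(1 - w powi (4 * (2 * n + 1))) * bilat w 4 3 1 n (n + 1)
    = (1 - w powi (4 * n + 2)) * bilat w 4 3 1 n n"
proof -
  have "bilat w 4 3 1 n n = - (w powi 2) * bilat w 4 3 5 (n - 1) (n + 1)"
    using bilat_shift[OF w_nonzero norm_w, of 4 3 "-1" n n] bilat_reflect[of w 4 3 1 n n] by simp
  moreover have "w powi (4 * (n + 1)) = w powi (4 * n + 2) * w powi 2"
    using w_nonzero by (simp flip: power_int_add add: algebra_simps del: power_int_numeral)
  ultimately have "w powi (4 * (n + 1)) * bilat w 4 3 5 (n - 1) (n + 1)
      = - (w powi (4 * n + 2)) * bilat w 4 3 1 n n"
    by (simp add: mult_ac)
  moreover have "(1 - w powi (4 * (2 * n + 1))) * bilat w 4 3 1 n (n + 1)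
      = bilat w 4 3 1 n n + w powi (4 * (n + 1)) * bilat w 4 3 5 (n - 1) (n + 1)"
    using bilat_pascal[OF w_nonzero norm_w, of 4 n "n + 1" 3 1] by (simp add: algebra_simps)
  ultimately show ?thesis
    by (simp add: algebra_simps)
qed

text \<open>Reflected to coefficient -1, the q-Pascal rule has as its second term the sum with
  coefficient 3, which vanishes.\<close>

lemma bilat_4_3_even:
  "(1 - w powi (4 * (2 * n + 2))) * bilat w 4 3 1 (n + 1) (n + 1) = bilat w 4 3 1 n (n + 1)"
proof -
  have "bilat w 4 3 1 (n + 1) (n + 1) = bilat w 4 3 (-1) (n + 1) (n + 1)"
    "bilat w 4 3 1 n (n + 1) = bilat w 4 3 (-1) (n + 1) n"
    using bilat_reflect[of w 4 3 1 "n + 1" "n + 1"] bilat_reflect[of w 4 3 1 n "n + 1"] by simp_all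
  then show ?thesis
    using bilat_pascal[OF w_nonzero norm_w, of 4 "n + 1" "n + 1" 3 "-1"] bilat_4_3_vanish[of n]
    by (simp add: algebra_simps)
qed

lemma bilat_4_3_central:
  assumes "n \<ge> 0"
  shows "bilat w 4 3 (-3) n n = w powi (4 * n) * bilat w 4 3 1 n n"
\<comment> \<open>For n = 0 the factor \<open>1 - w powi (8 * n)\<close> is zero and cannot be
  cancelled.\<close>
proof (cases "n = 0")
  case False
  then have nz: "1 - w powi (8 * n) \<noteq> 0"
    using one_minus_w_powi_nonzero assms by simp
  have "bilat w 4 3 (-3) n (n - 1) = 0"
    using bilat_4_3_vanish[of "n - 1"] bilat_reflect[of w 4 3 "-3" n "n - 1"] by simp
  then have "(1 - w powi (8 * n)) * bilat w 4 3 (-3) n n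
      = w powi (4 * n) * bilat w 4 3 1 (n - 1) n"
    using bilat_pascal[OF w_nonzero norm_w, of 4 n n 3 "-3"] by simp
  also have "\<dots> = (1 - w powi (8 * n)) * (w powi (4 * n) * bilat w 4 3 1 n n)"
    using bilat_4_3_even[of "n - 1"] by (simp add: mult_ac)
  finally show ?thesis
    using nz by simp
qed (simp add: bilat_0)

text \<open>The Bailey pair of the second identity. Translation carries the second q-Pascal term to
  coefficient -3, where \<open>bilat_4_3_central\<close> applies; both sides then share the factor
  \<open>1 - w powi (8 * n + 4)\<close>.\<close>

lemma bilat_4_3_neg_odd:
  assumes "n \<ge> 0"
  shows "bilat w 4 3 (-1) n (n + 1) = bilat w 4 3 1 n n"
proof -
  let ?A = "bilat w 4 3 1 n n"
  have shift: "bilat w 4 3 3 (n - 1) (n + 1) = - bilat w 4 3 (-3) n n"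
    using bilat_shift[OF w_nonzero norm_w, of 4 3 "-3" n n] by simp
  have "(1 - w powi (8 * n + 4)) * bilat w 4 3 (-1) n (n + 1)
      = bilat w 4 3 (-1) n n + w powi (4 * (n + 1)) * bilat w 4 3 3 (n - 1) (n + 1)"
    using bilat_pascal[OF w_nonzero norm_w, of 4 n "n + 1" 3 "-1"] by (simp add: algebra_simps)
  also have "\<dots> = ?A - w powi (4 * (n + 1)) * w powi (4 * n) * ?A"
    using bilat_reflect[of w 4 3 1 n n] unfolding shift bilat_4_3_central[OF assms] by simp
  also have "w powi (4 * (n + 1)) * w powi (4 * n) = w powi (8 * n + 4)"
    using w_nonzero by (simp flip: power_int_add)
  finally have "(1 - w powi (8 * n + 4)) * bilat w 4 3 (-1) n (n + 1) = (1 - w powi (8 * n + 4)) * ?A"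
    by (simp add: algebra_simps)
  then show ?thesis
    using one_minus_w_powi_nonzero[of "8 * n + 4"] assms by simp
qed

text \<open>Climb from (n, n) over (n, n + 1) to (n + 1, n + 1). Each half-step adds a factor to the
  denominator, only the first adds one to the numerator.\<close>

lemma bilat_4_3_eq:
  "bilat w 4 3 1 (int n) (int n)
    = qpoch (w powi 2) (w powi 4) n / qpoch (w powi 4) (w powi 4) (2 * n)"
proof (induction n)
  case (Suc n)
  define A B where "A = 1 - w powi (4 * (2 * int n + 1))" and "B = 1 - w powi (4 * (2 * int n + 2))"
  have nz: "A \<noteq> 0" "B \<noteq> 0"
    unfolding A_def B_def by (intro one_minus_w_powi_nonzero; simp)+
  have "bilat w 4 3 1 (int n + 1) (int n + 1) = bilat w 4 3 1 (int n) (int n + 1) / B"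
    using bilat_4_3_even[of "int n"] nz by (simp add: B_def field_simps)
  also have "bilat w 4 3 1 (int n) (int n + 1) = (1 - w powi (4 * int n + 2)) * bilat w 4 3 1 (int n) (int n) / A"
    using bilat_4_3_odd[of "int n"] nz by (simp add: A_def field_simps)
  finally have "bilat w 4 3 1 (int (Suc n)) (int (Suc n))
      = (1 - w powi (4 * int n + 2)) * bilat w 4 3 1 (int n) (int n) / A / B"
    by (simp add: add.commute)
  moreover have "qpoch (w powi 4) (w powi 4) (2 * Suc n) = qpoch (w powi 4) (w powi 4) (2 * n) * A * B"
    by (simp add: qpoch_powi_Suc[OF w_nonzero norm_w] A_def B_def algebra_simps del: power_int_numeral)
  moreover have "qpoch (w powi 2) (w powi 4) (Suc n) = qpoch (w powi 2) (w powi 4) n * (1 - w powi (4 * int n + 2))"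
    by (simp add: qpoch_powi_Suc[OF w_nonzero norm_w] add.commute del: power_int_numeral)
  ultimately show ?case
    unfolding Suc.IH by simp
qed (simp add: bilat_0)

text \<open>The intermediate stage of that climb is the Bailey pair of the third identity.\<close>

lemma bilat_4_3_odd_eq:
  "bilat w 4 3 1 (int n) (int n + 1)
    = qpoch (w powi 2) (w powi 4) (Suc n) / qpoch (w powi 4) (w powi 4) (2 * n + 1)"
proof -
  define A where "A = 1 - w powi (4 * (2 * int n + 1))"
  have nz: "A \<noteq> 0"
    unfolding A_def by (intro one_minus_w_powi_nonzero; simp)
  have "bilat w 4 3 1 (int n) (int n + 1) = (1 - w powi (4 * int n + 2)) * bilat w 4 3 1 (int n) (int n) / A"
    using bilat_4_3_odd[of "int n"] nz by (simp add: A_def field_simps)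
  moreover have "qpoch (w powi 4) (w powi 4) (2 * n + 1) = qpoch (w powi 4) (w powi 4) (2 * n) * A"
    by (simp add: qpoch_powi_Suc[OF w_nonzero norm_w] A_def algebra_simps del: power_int_numeral)
  moreover have "qpoch (w powi 2) (w powi 4) (Suc n) = qpoch (w powi 2) (w powi 4) n * (1 - w powi (4 * int n + 2))"
    by (simp add: qpoch_powi_Suc[OF w_nonzero norm_w] add.commute del: power_int_numeral)
  ultimately show ?thesis
    unfolding bilat_4_3_eq by simp
qed

section \<open>From Bailey pairs to theta series\<close>

text \<open>Interchange the sums over i and r. The inner one is a Durfee sum with k = 2r + s, whose
  value does not depend on r; \<open>s\<close> distinguishes Bailey pairs relative to 1 and to
  \<open>w powi 4\<close>.\<close>

lemma bailey_limit_int: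
  assumes c: "\<bar>c\<bar> < 3" and s: "s = 0 \<or> s = 1"
  shows "(\<Sum>\<^sub>\<infinity>i. w powi (4 * i^2 + 4 * s * i) * bilat w 4 3 c i (i + s))
    = theta w 7 (c + 4 * s) / qpoch_inf (w powi 4) (w powi 4)"
proof -
  let ?Q = "w powi 4"
  define F where "F i r = w powi (4 * i^2 + 4 * s * i) * bilat_term w 4 3 c i (i + s) r" for i r
  have Q: "norm ?Q < 1" "?Q \<noteq> 0"
    using norm_powi_less_1[OF w_nonzero norm_w, of 4] w_nonzero by simp_all
  obtain K where K: "K > 0" "\<And>k. norm (rfac ?Q k) \<le> K"
    using rfac_bounded[OF Q(1)] by blast
  have bound: "norm (F i r) \<le> norm w powi \<bar>i\<bar> * (norm w powi \<bar>r\<bar> * (K * K))" for i r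
  proof (cases "i \<ge> 0")
    case True
    have "i * 1 \<le> i * i" if "i > 0"
      using that by (intro mult_left_mono) auto
    then have "\<bar>i\<bar> \<le> 4 * i^2"
      using True by (cases "i = 0") (auto simp: power2_eq_square)
    then have "\<bar>i\<bar> \<le> 4 * i^2 + 4 * s * i"
      using s True by auto
    then have 1: "norm (w powi (4 * i^2 + 4 * s * i)) \<le> norm w powi \<bar>i\<bar>"
      by (intro norm_power_int_le norm_w) auto
    have 2: "norm (rfac ?Q (i - r) * rfac ?Q (i + s + r)) \<le> K * K"
      unfolding norm_mult by (intro mult_mono) (use K in \<open>auto intro: less_imp_le\<close>)
    have "norm (bilat_term w 4 3 c i (i + s) r) \<le> norm w powi \<bar>r\<bar> * (K * K)"
      unfolding bilat_term_def norm_mult[of "_ * _" "_ * _"]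
      by (intro mult_mono norm_theta_term_le[OF w_nonzero norm_w] c 2) auto
    with 1 show ?thesis
      unfolding F_def norm_mult[of "_ powi _"] by (intro mult_mono) auto
  next
    case False
    \<comment> \<open>The support from -(i + s) to i is empty, as 2i + s is negative.\<close>
    then have "bilat_term w 4 3 c i (i + s) r = 0"
      using s by (intro bilat_term_eq_0) auto
    then show ?thesis
      using K by (simp add: F_def)
  qed
  have "(\<lambda>(i, r). F i r) summable_on UNIV \<times> UNIV"
  proof (rule summable_on_norm_bound)
    have geo: "(\<lambda>r::int. norm w powi \<bar>r\<bar>) summable_on UNIV"
      by (rule summable_power_abs_int) (use norm_w in auto)
    show "(\<lambda>(i, r). norm w powi \<bar>i\<bar> * (norm w powi \<bar>r\<bar> * (K * K))) summable_on (UNIV \<times> UNIV :: (int \<times> int) set)"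
      using K(1) geo
      by (intro summable_on_SigmaI[where g = "\<lambda>i. norm w powi \<bar>i\<bar> * ((\<Sum>\<^sub>\<infinity>r::int. norm w powi \<bar>r\<bar>) * (K * K))"])
        (auto intro!: has_sum_cmult_right has_sum_cmult_left summable_on_cmult_left)
  qed (use bound in auto)
  then have swap: "(\<Sum>\<^sub>\<infinity>i. \<Sum>\<^sub>\<infinity>r. F i r) = (\<Sum>\<^sub>\<infinity>r. \<Sum>\<^sub>\<infinity>i. F i r)"
    by (rule infsum_swap_banach)
  have inner: "(\<Sum>\<^sub>\<infinity>i. F i r) = (-1) powi r * w powi (7 * r^2 + (c + 4 * s) * r) * (1 / qpoch_inf ?Q ?Q)" for r
  proof -
    \<comment> \<open>Substituting i = m + r splits the exponent into a part in r alone and four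
      times m(m + 2r + s).\<close>
    have "F (m + r) r = (-1) powi r * w powi (7 * r^2 + (c + 4 * s) * r) * durfee_term ?Q (2 * r + s) m" for m
    proof -
      have exponent: "w powi (4 * (m + r)^2 + 4 * s * (m + r)) * w powi (3 * r^2 + c * r)
          = w powi (7 * r^2 + (c + 4 * s) * r) * w powi (4 * (m * (m + (2 * r + s))))"
        by (rule w_powi_eq[OF w_nonzero norm_w]) (simp add: algebra_simps power2_eq_square)
      have eqs: "m + r - r = m" "m + r + s + r = m + (2 * r + s)"
        by simp_all
      have "F (m + r) r = (-1) powi r * (w powi (4 * (m + r)^2 + 4 * s * (m + r)) * w powi (3 * r^2 + c * r))
          * (rfac ?Q m * rfac ?Q (m + (2 * r + s)))"
        unfolding F_def bilat_term_def eqs by (simp add: mult_ac)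
      also have "\<dots> = (-1) powi r * w powi (7 * r^2 + (c + 4 * s) * r) * durfee_term ?Q (2 * r + s) m"
        unfolding exponent durfee_term_def power_int_mult[of w 4] by (simp only: mult.assoc)
      finally show ?thesis .
    qed
    then have "(\<Sum>\<^sub>\<infinity>i. F i r)
        = (\<Sum>\<^sub>\<infinity>m. (-1) powi r * w powi (7 * r^2 + (c + 4 * s) * r) * durfee_term ?Q (2 * r + s) m)"
      by (intro infsum_reindex_bij_witness[symmetric, of _ "\<lambda>i. i - r" "\<lambda>m. m + r"]) auto
    then show ?thesis
      using durfee_eq[OF Q(2,1), of "2 * r + s"] by (simp only: infsum_cmult_right' durfee_def)
  qed
  have "(\<Sum>\<^sub>\<infinity>i. w powi (4 * i^2 + 4 * s * i) * bilat w 4 3 c i (i + s)) = (\<Sum>\<^sub>\<infinity>i. \<Sum>\<^sub>\<infinity>r. F i r)"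
    by (simp only: F_def bilat_def infsum_cmult_right')
  also have "\<dots> = theta w 7 (c + 4 * s) * (1 / qpoch_inf ?Q ?Q)"
    unfolding swap inner theta_def by (rule infsum_cmult_left')
  finally show ?thesis
    by simp
qed

lemma bailey_limit:
  assumes "\<bar>c\<bar> < 3" and s: "s = 0 \<or> s = 1"
  shows "(\<Sum>\<^sub>\<infinity>n::nat. w powi (4 * (int n)^2 + 4 * s * int n) * bilat w 4 3 c (int n) (int n + s))
    = theta w 7 (c + 4 * s) / qpoch_inf (w powi 4) (w powi 4)"
proof -
  let ?f = "\<lambda>i. w powi (4 * i^2 + 4 * s * i) * bilat w 4 3 c i (i + s)"
  have "infsum ?f UNIV = infsum ?f (range int)"
  proof (rule infsum_cong_neutral)
    fix i assume "i \<in> UNIV - range int"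
    then have "i < 0"
      by (metis DiffD2 not_le rangeI zero_le_imp_eq_int)
    then show "?f i = 0"
      using s by (auto intro: bilat_neg)
  qed auto
  also have "\<dots> = (\<Sum>\<^sub>\<infinity>n::nat. ?f (int n))"
    by (subst infsum_reindex) (auto simp: o_def)
  finally show ?thesis
    using bailey_limit_int[OF assms] by simp
qed

end

section \<open>The double sums\<close>

text \<open>Sum over j first by \<open>euler_infsum\<close>. The bounds on \<open>z\<close> and
  \<open>g\<close> give a product of geometric majorants, hence unconditional summability over
  pairs.\<close>

lemma euler_double_sum:
  fixes q :: complex
  assumes q: "norm q < 1" and x: "norm x < 1"
    and z: "\<And>i. norm (z i) \<le> norm q" and g: "\<And>i. norm (g i) \<le> norm q ^ i * C"
  shows "((\<lambda>(i::nat, j::nat). g i * (z i ^ j / qpoch x x j)) has_sum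
    (\<Sum>\<^sub>\<infinity>i. g i / qpoch_inf (z i) x)) UNIV"
proof -
  obtain K where K: "K > 0" "\<And>k. norm (rfac x k) \<le> K"
    using rfac_bounded[OF x] by blast
  have C: "C \<ge> 0"
    using order_trans[OF norm_ge_zero g[of 0]] by simp
  have geo: "(\<lambda>j. norm q ^ j) summable_on UNIV"
    by (intro norm_summable_imp_summable_on) (use q in \<open>auto simp: norm_power summable_geometric\<close>)
  let ?f = "\<lambda>(i::nat, j::nat). g i * (z i ^ j / qpoch x x j)"
  have bound: "norm (g i * (z i ^ j / qpoch x x j)) \<le> (norm q ^ i * C) * (norm q ^ j * K)" for i j
  proof -
    have "norm (z i ^ j * rfac x (int j)) \<le> norm q ^ j * K"
      unfolding norm_mult norm_power using K z by (intro mult_mono power_mono) auto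
    then have "norm (z i ^ j / qpoch x x j) \<le> norm q ^ j * K"
      by (simp add: rfac_of_nat)
    then show ?thesis
      unfolding norm_mult[of "g i"] using g C by (intro mult_mono) auto
  qed
  have "?f summable_on UNIV \<times> UNIV"
  proof (rule summable_on_norm_bound)
    show "(\<lambda>(i, j). (norm q ^ i * C) * (norm q ^ j * K)) summable_on (UNIV \<times> UNIV :: (nat \<times> nat) set)"
      using K(1) C geo
      by (intro summable_on_SigmaI[where g = "\<lambda>i. (norm q ^ i * C) * ((\<Sum>\<^sub>\<infinity>j. norm q ^ j) * K)"])
        (auto intro!: has_sum_cmult_right has_sum_cmult_left summable_on_cmult_left)
  qed (use bound in auto)
  then have "(?f has_sum infsum ?f (UNIV \<times> UNIV)) (UNIV \<times> UNIV)"
    and "infsum ?f (UNIV \<times> UNIV) = (\<Sum>\<^sub>\<infinity>i. \<Sum>\<^sub>\<infinity>j. ?f (i, j))"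
    using infsum_Sigma_banach[of ?f UNIV "\<lambda>_. UNIV"] by simp_all
  moreover have "(\<Sum>\<^sub>\<infinity>j. ?f (i, j)) = g i / qpoch_inf (z i) x" for i
  proof -
    have "(\<Sum>\<^sub>\<infinity>j. ?f (i, j)) = g i * (\<Sum>\<^sub>\<infinity>j. z i ^ j / qpoch x x j)"
      unfolding prod.case by (rule infsum_cmult_right')
    then show ?thesis
      using euler_infsum[OF x, of "z i"] z[of i] q by simp
  qed
  ultimately show ?thesis
    by simp
qed

lemma gaussian_term_bounded:
  fixes q x :: complex
  assumes q: "norm q < 1" and x: "norm x < 1" and e: "\<And>i. i \<le> e i"
  obtains C where "\<And>i. norm (q ^ e i / qpoch x x (l i)) \<le> norm q ^ i * C"
proof -
  obtain K where K: "K > 0" "\<And>k. norm (rfac x k) \<le> K"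
    using rfac_bounded[OF x] by blast
  have "norm (q ^ e i * rfac x (int (l i))) \<le> norm q ^ i * K" for i
    unfolding norm_mult norm_power using K q e by (intro mult_mono power_decreasing) auto
  with that[of K] show thesis
    by (simp add: rfac_of_nat)
qed

section \<open>Specialisation to a square root of q\<close>

context
  fixes q w :: complex
  assumes q_nonzero: "q \<noteq> 0" and norm_q: "norm q < 1" and w_square: "w ^ 2 = q"
begin

lemma sqrt_nonzero: "w \<noteq> 0"
  using q_nonzero w_square by auto

lemma norm_sqrt: "norm w < 1"
proof -
  have "norm w ^ 2 < 1"
    using norm_q w_square by (metis norm_power)
  then show ?thesis
    by (simp add: power_less_one_iff)
qed

lemma sqrt_powi: "w powi (2 * int n) = q ^ n"
  by (simp add: power_int_mult w_square)

lemma norm_q_square: "norm (q ^ 2) < 1"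
  using norm_q by (simp add: norm_power power_less_one_iff)

lemma theta_eq_qpoch_inf_list:
  assumes "int a + int b = 7" "\<bar>c\<bar> < 7" "7 - c = 2 * int a"
  shows "theta w 7 c = qpoch_inf_list [q ^ a, q ^ b, q ^ 7] (q ^ 7)"
proof -
  have "7 + c = 2 * int b"
    using assms by simp
  then have powers: "w powi (7 - c) = q ^ a" "w powi (7 + c) = q ^ b" "w powi (2 * 7) = q ^ 7"
    using assms(3) sqrt_powi[of a] sqrt_powi[of b] sqrt_powi[of 7] by simp_all
  show ?thesis
    unfolding jacobi_triple_product[OF sqrt_nonzero norm_sqrt assms(2)] powers
    by (simp add: qpoch_inf_list_def)
qed

text \<open>Turns the product left by Euler's identity into the numerator of a Bailey pair.\<close>

lemma qpoch_inf_odd: "1 / qpoch_inf (q ^ (2 * n + 1)) (q ^ 2) = qpoch q (q ^ 2) n / qpoch_inf q (q ^ 2)"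
proof -
  have eq: "q * (q ^ 2) ^ n = q ^ (2 * n + 1)"
    by (simp add: power_mult)
  then have "qpoch q (q ^ 2) n * qpoch_inf (q ^ (2 * n + 1)) (q ^ 2) = qpoch_inf q (q ^ 2)"
    using qpoch_inf_shift[OF norm_q_square, of q n] by (simp only: eq)
  then show ?thesis
    using qpoch_inf_nonzero[OF norm_q_square norm_q] by (auto simp: divide_simps)
qed

text \<open>Common form of the three identities: \<open>s\<close> sets the linear exponent in i,
  \<open>t\<close> the offset of the denominator, and \<open>c\<close> selects the Bailey pair. The
  infinite products to bases \<open>q\<close> and \<open>q^2\<close> merge by
  \<open>qpoch_inf_double\<close>.\<close>

lemma double_sum_eq_theta:
  assumes c: "\<bar>c\<bar> < 3" and s: "s \<le> 1" and t: "t \<le> 1"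
    and closed: "\<And>n. bilat w 4 3 c (int n) (int n + int s)
      = qpoch q (q ^ 2) (n + t) / qpoch (q ^ 2) (q ^ 2) (2 * n + t)"
  shows "((\<lambda>(i::nat, j::nat). q ^ (2 * i^2 + 2 * s * i) / qpoch (q^2) (q^2) (2 * i + t)
      * ((q ^ (2 * (i + t) + 1)) ^ j / qpoch (q^2) (q^2) j))
    has_sum (theta w 7 (c + 4 * int s) / qpoch_inf q q)) UNIV"
proof -
  let ?g = "\<lambda>i. q ^ (2 * i^2 + 2 * s * i) / qpoch (q^2) (q^2) (2 * i + t)"
  have s': "int s = 0 \<or> int s = 1"
    using s by auto
  have "i \<le> 2 * i^2 + 2 * s * i" for i :: nat
    by (cases i) (auto simp: power2_eq_square)
  then obtain C where C: "\<And>i. norm (?g i) \<le> norm q ^ i * C"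
    using gaussian_term_bounded[OF norm_q norm_q_square,
        where e = "\<lambda>i. 2 * i^2 + 2 * s * i" and l = "\<lambda>i. 2 * i + t"] by blast
  have z: "norm (q ^ (2 * (i + t) + 1)) \<le> norm q" for i
    unfolding norm_power using power_decreasing[of 1 "2 * (i + t) + 1" "norm q"] norm_q by simp
  have term_eq: "?g i / qpoch_inf (q ^ (2 * (i + t) + 1)) (q^2)
      = w powi (4 * (int i)^2 + 4 * int s * int i) * bilat w 4 3 c (int i) (int i + int s)
        * (1 / qpoch_inf q (q^2))" for i
  proof -
    have "w powi (4 * (int i)^2 + 4 * int s * int i) = q ^ (2 * i^2 + 2 * s * i)"
      using sqrt_powi[of "2 * i^2 + 2 * s * i"] by (simp add: algebra_simps)
    then show ?thesis
      using qpoch_inf_odd[of "i + t"] unfolding closed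
      by (simp add: divide_inverse mult_ac)
  qed
  have "(\<Sum>\<^sub>\<infinity>i. ?g i / qpoch_inf (q ^ (2 * (i + t) + 1)) (q^2))
      = theta w 7 (c + 4 * int s) / qpoch_inf (w powi 4) (w powi 4) * (1 / qpoch_inf q (q^2))"
    unfolding term_eq infsum_cmult_left' bailey_limit[OF sqrt_nonzero norm_sqrt c s'] ..
  also have "w powi 4 = q^2"
    using sqrt_powi[of 2] by simp
  also have "theta w 7 (c + 4 * int s) / qpoch_inf (q^2) (q^2) * (1 / qpoch_inf q (q^2))
      = theta w 7 (c + 4 * int s) / qpoch_inf q q"
    by (simp add: qpoch_inf_double[OF norm_q] mult_ac)
  finally show ?thesis
    using euler_double_sum[where z = "\<lambda>i. q ^ (2 * (i + t) + 1)" and g = ?g,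
        OF norm_q norm_q_square z C] by (simp only:)
qed

lemma mod_7_identities:
  shows "((\<lambda>(i::nat, j::nat). q ^ (2 * i^2 + 2 * i * j + j) /
            (qpoch (q^2) (q^2) (2 * i) * qpoch (q^2) (q^2) j))
          has_sum (qpoch_inf_list [q^3, q^4, q^7] (q^7) / qpoch_inf q q)) UNIV" (is ?A)
    and "((\<lambda>(i::nat, j::nat). q ^ (2 * i^2 + 2 * i * j + 2 * i + j) /
            (qpoch (q^2) (q^2) (2 * i) * qpoch (q^2) (q^2) j))
          has_sum (qpoch_inf_list [q^2, q^5, q^7] (q^7) / qpoch_inf q q)) UNIV" (is ?B)
    and "((\<lambda>(i::nat, j::nat). q ^ (2 * i^2 + 2 * i * j + 2 * i + 3 * j) /
            (qpoch (q^2) (q^2) (2 * i + 1) * qpoch (q^2) (q^2) j))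
          has_sum (qpoch_inf_list [q, q^6, q^7] (q^7) / qpoch_inf q q)) UNIV" (is ?C)
proof -
  have w: "w powi 2 = q" "w powi 4 = q^2"
    using sqrt_powi[of 1] sqrt_powi[of 2] by simp_all
  note closed = bilat_4_3_eq[OF sqrt_nonzero norm_sqrt, unfolded w]
    bilat_4_3_odd_eq[OF sqrt_nonzero norm_sqrt, unfolded w]
    bilat_4_3_neg_odd[OF sqrt_nonzero norm_sqrt]
  \<comment> \<open>The coefficients 1, 3, 5 are \<open>c + 4 * s\<close> for (c, s) = (1, 0), (-1,
    1), (1, 1).\<close>
  have "theta w 7 1 = qpoch_inf_list [q^3, q^4, q^7] (q^7)"
    "theta w 7 3 = qpoch_inf_list [q^2, q^5, q^7] (q^7)"
    "theta w 7 5 = qpoch_inf_list [q^1, q^6, q^7] (q^7)"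
    by (rule theta_eq_qpoch_inf_list; simp)+
  note theta = this[unfolded power_one_right]
  have "q ^ (2 * i^2 + 2 * i * j + j) = q ^ (2 * i^2 + 2 * 0 * i) * (q ^ (2 * (i + 0) + 1)) ^ j" for i j
    by (simp add: algebra_simps flip: power_add power_mult)
  then show ?A
    using double_sum_eq_theta[of "1" 0 0] closed theta by simp
  have "q ^ (2 * i^2 + 2 * i * j + 2 * i + j) = q ^ (2 * i^2 + 2 * 1 * i) * (q ^ (2 * (i + 0) + 1)) ^ j" for i j
    by (simp add: algebra_simps flip: power_add power_mult)
  then show ?B
    using double_sum_eq_theta[of "-1" 1 0] closed theta by simp
  \<comment> \<open>Here j is multiplied by 2i + 3, which forces t = 1.\<close>
  have "q ^ (2 * i^2 + 2 * i * j + 2 * i + 3 * j) = q ^ (2 * i^2 + 2 * 1 * i) * (q ^ (2 * (i + 1) + 1)) ^ j" for i j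
    by (simp add: algebra_simps flip: power_add power_mult)
  then show ?C
    using double_sum_eq_theta[of "1" 1 1] closed theta by simp
qed

end

lemma has_sum_only_origin:
  fixes f :: "nat \<times> nat \<Rightarrow> complex"
  assumes "\<And>p. p \<noteq> (0, 0) \<Longrightarrow> f p = 0" "f (0, 0) = c"
  shows "(f has_sum c) UNIV"
  by (rule has_sum_finite_neutralI[of "{(0, 0)}"]) (use assms in simp_all)

theorem theorem3p4:
  fixes q :: complex
  assumes "norm q < 1"
  shows "((\<lambda>(i::nat, j::nat). q ^ (2 * i^2 + 2 * i * j + j) /
            (qpoch (q^2) (q^2) (2 * i) * qpoch (q^2) (q^2) j))
          has_sum (qpoch_inf_list [q^3, q^4, q^7] (q^7) / qpoch_inf q q)) UNIV
       \<and> ((\<lambda>(i::nat, j::nat). q ^ (2 * i^2 + 2 * i * j + 2 * i + j) /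
            (qpoch (q^2) (q^2) (2 * i) * qpoch (q^2) (q^2) j))
          has_sum (qpoch_inf_list [q^2, q^5, q^7] (q^7) / qpoch_inf q q)) UNIV
       \<and> ((\<lambda>(i::nat, j::nat). q ^ (2 * i^2 + 2 * i * j + 2 * i + 3 * j) /
            (qpoch (q^2) (q^2) (2 * i + 1) * qpoch (q^2) (q^2) j))
          has_sum (qpoch_inf_list [q, q^6, q^7] (q^7) / qpoch_inf q q)) UNIV"
proof (cases "q = 0")
  case True
  \<comment> \<open>Negative powers of \<open>w\<close> exclude q = 0 above. Here each exponent is
    zero only at i = j = 0, so a single summand remains.\<close>
  have "qpoch_inf 0 0 = 1" "qpoch 0 0 n = 1" for n
    by (simp_all add: qpoch_inf_def qpoch_def)
  then show ?thesis
    unfolding True by (intro conjI has_sum_only_origin) (auto simp: qpoch_inf_list_def power_0_left split: if_splits)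
next
  case False
  then show ?thesis
    using mod_7_identities[OF False assms power2_csqrt] by blast
qed

end
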